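(* Let $p,n\ge 0$ be integers with $p+n\ge3$ such that $|p-n|$ is a prime power, so that the field $GF(|p-n|)$ exists. If $G$ is a minimal $(p+n)$-cross-theta that is a balanced subdivision of an $L_{p+n}$ with $p$ entrant and $n$ salient arrows, then $G$ is minimally dependent over $GF(|p-n|)$.
   Context: An oriented hypergraph is a quintuple $G=(V,E,I,\iota,\sigma)$ with finite sets of vertices $V$, edges $E$, incidences $I$, an incidence function $\iota:I\to V\times E$ (not necessarily injective), and an orientation $\sigma:I\to\{+1,-1\}$; an incidence with $\sigma=+1$ is an entrant arrow and one with $\sigma=-1$ is a salient arrow. The incidence matrix is the $V\times E$ matrix whose $(v,e)$-entry is the sum of $\sigma(i)$ over all $i$ with $\iota(i)=(v,e)$. $G$ is minimally dependent over a field if the columns of the incidence matrix, with entries regarded in that field, are linearly dependent but every proper subset of columns is linearly independent. A path of length $m/2$ is a non-repeating sequence $(a_0,i_1,a_1,\dots,i_m,a_m)$, where the $a_j$ alternate between vertices and edges and $i_j$ is an incidence between $a_{j-1}$ and $a_j$. A circle is a closed path. The sign of a circle with $m$ incidences is $(-1)^{\lfloor m/2\rfloor}\prod_{j=1}^m\sigma(i_j)$. A $k$-cross-theta ($k\ge3$) consists of $k$ internally disjoint paths of half-integer length with common end-points (one a vertex, one an edge); it is minimal if it consists of exactly these $k$ paths and nothing else. $L_k$ is the hypergraph with a single vertex, a single edge and $k$ incidences between them. A subdivision of an edge $e$ replaces $e$ by two edges $e_1,e_2$, a new vertex $w$ and two new incidences $j_1,j_2$ at $w$ with $j_1\in I(e_1)$,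 $j_2\in I(e_2)$, $I(e_1)\cap I(e_2)=\emptyset$ and $(I(e_1)\setminus j_1)\cup(I(e_2)\setminus j_2)=I(e)$, where $I(x)$ is the set of incidences of $x$; the term is also used for iterated subdivisions (including none). A balanced subdivision is one in which the signs of corresponding circles do not change. *)

theory Defs
  imports "HOL-Library.Cardinality" "HOL-Number_Theory.Prime_Powers"
begin

record ('v, 'e, 'i) ohg =
  verts :: "'v set"
  edges :: "'e set"
  incs :: "'i set"
  inc_map :: "'i \<Rightarrow> 'v \<times> 'e"
  orient :: "'i \<Rightarrow> int"

text \<open>Entrant arrows have orientation \<open>1\<close>, salient arrows have orientation \<open>-1\<close>. The values of
  \<open>inc_map\<close> and \<open>orient\<close> outside \<open>incs\<close> are irrelevant.\<close>

locale oriented_hypergraph =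
  fixes G :: "('v, 'e, 'i) ohg"
  assumes finite_verts: "finite (verts G)"
    and finite_edges: "finite (edges G)"
    and finite_incs: "finite (incs G)"
    and inc_map_in: "i \<in> incs G \<Longrightarrow> inc_map G i \<in> verts G \<times> edges G"
    and orient_in: "i \<in> incs G \<Longrightarrow> orient G i \<in> {1, -1}"

definition edge_incs :: "('v, 'e, 'i) ohg \<Rightarrow> 'e \<Rightarrow> 'i set" where
  "edge_incs G e = {i \<in> incs G. snd (inc_map G i) = e}"

definition incidence_matrix :: "('v, 'e, 'i) ohg \<Rightarrow> 'v \<Rightarrow> 'e \<Rightarrow> int" where
  "incidence_matrix G v e = (\<Sum>i | i \<in> incs G \<and> inc_map G i = (v, e). orient G i)"

text \<open>Columns are treated as a family indexed by the edges, not as a set of vectors, so that two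
  edges with equal columns are dependent.\<close>

definition columns_independent ::
    "'f::field itself \<Rightarrow> ('v, 'e, 'i) ohg \<Rightarrow> 'e set \<Rightarrow> bool" where
  "columns_independent F G S \<longleftrightarrow>
     (\<forall>c :: 'e \<Rightarrow> 'f.
        (\<forall>v \<in> verts G. (\<Sum>e\<in>S. c e * of_int (incidence_matrix G v e)) = 0)
          \<longrightarrow> (\<forall>e\<in>S. c e = 0))"

definition minimally_dependent :: "'f::field itself \<Rightarrow> ('v, 'e, 'i) ohg \<Rightarrow> bool" where
  "minimally_dependent F G \<longleftrightarrow>
     \<not> columns_independent F G (edges G) \<and>
     (\<forall>S. S \<subset> edges G \<longrightarrow> columns_independent F G S)"

text \<open>A sequence \<open>(a\<^sub>0, i\<^sub>1, a\<^sub>1, \<dots>, i\<^sub>m, a\<^sub>m)\<close> is represented by the pair of lists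
  \<open>([a\<^sub>0, \<dots>, a\<^sub>m], [i\<^sub>1, \<dots>, i\<^sub>m])\<close>, with \<open>Inl\<close> marking vertices and \<open>Inr\<close> marking edges.
  The \<open>a\<^sub>j\<close> alternate between vertices and edges by the definition of \<open>joins\<close>.\<close>

type_synonym ('v, 'e, 'i) trail = "('v + 'e) list \<times> 'i list"

definition joins :: "('v, 'e, 'i) ohg \<Rightarrow> 'i \<Rightarrow> 'v + 'e \<Rightarrow> 'v + 'e \<Rightarrow> bool" where
  "joins G i a b \<longleftrightarrow> i \<in> incs G \<and>
     (\<exists>v e. inc_map G i = (v, e) \<and> (a = Inl v \<and> b = Inr e \<or> a = Inr e \<and> b = Inl v))"

definition is_walk :: "('v, 'e, 'i) ohg \<Rightarrow> ('v, 'e, 'i) trail \<Rightarrow> bool" where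
  "is_walk G P \<longleftrightarrow>
     length (fst P) = Suc (length (snd P)) \<and>
     set (fst P) \<subseteq> Inl ` verts G \<union> Inr ` edges G \<and>
     (\<forall>j < length (snd P). joins G (snd P ! j) (fst P ! j) (fst P ! Suc j))"

definition is_path :: "('v, 'e, 'i) ohg \<Rightarrow> ('v, 'e, 'i) trail \<Rightarrow> bool" where
  "is_path G P \<longleftrightarrow> is_walk G P \<and> distinct (fst P) \<and> distinct (snd P)"

definition is_circle :: "('v, 'e, 'i) ohg \<Rightarrow> ('v, 'e, 'i) trail \<Rightarrow> bool" where
  "is_circle G C \<longleftrightarrow> is_walk G C \<and> snd C \<noteq> [] \<and> hd (fst C) = last (fst C) \<and>
     distinct (butlast (fst C)) \<and> distinct (snd C)"

definition circle_sign :: "('v, 'e, 'i) ohg \<Rightarrow> ('v, 'e, 'i) trail \<Rightarrow> int" where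
  "circle_sign G C = (-1) ^ (length (snd C) div 2) * prod_list (map (orient G) (snd C))"

text \<open>The interior of a path consists of its inner vertices and edges and of all its incidences;
  disjointness of incidences is what separates parallel paths of length one half.\<close>

definition internally_disjoint :: "('v, 'e, 'i) trail \<Rightarrow> ('v, 'e, 'i) trail \<Rightarrow> bool" where
  "internally_disjoint P Q \<longleftrightarrow>
     set (butlast (tl (fst P))) \<inter> set (fst Q) = {} \<and>
     set (butlast (tl (fst Q))) \<inter> set (fst P) = {} \<and>
     set (snd P) \<inter> set (snd Q) = {}"

definition cross_theta_paths ::
    "nat \<Rightarrow> ('v, 'e, 'i) ohg \<Rightarrow> (nat \<Rightarrow> ('v, 'e, 'i) trail) \<Rightarrow> bool" where
  "cross_theta_paths k G P \<longleftrightarrow> k \<ge> 3 \<and>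
     (\<exists>v e. \<forall>j<k. is_path G (P j) \<and> odd (length (snd (P j))) \<and>
        hd (fst (P j)) = Inl v \<and> last (fst (P j)) = Inr e) \<and>
     (\<forall>j<k. \<forall>l<k. j \<noteq> l \<longrightarrow> internally_disjoint (P j) (P l))"

definition minimal_cross_theta :: "nat \<Rightarrow> ('v, 'e, 'i) ohg \<Rightarrow> bool" where
  "minimal_cross_theta k G \<longleftrightarrow> oriented_hypergraph G \<and>
     (\<exists>P. cross_theta_paths k G P \<and>
        Inl ` verts G \<union> Inr ` edges G = (\<Union>j<k. set (fst (P j))) \<and>
        incs G = (\<Union>j<k. set (snd (P j))))"

definition is_L :: "nat \<Rightarrow> ('v, 'e, 'i) ohg \<Rightarrow> bool" where
  "is_L k H \<longleftrightarrow> oriented_hypergraph H \<and>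
     card (verts H) = 1 \<and> card (edges H) = 1 \<and> card (incs H) = k"

text \<open>Subdivision of the edge \<open>e\<close>. The old incidences keep their names, vertices and
  orientations; the orientations of \<open>j\<^sub>1\<close> and \<open>j\<^sub>2\<close> are arbitrary. One of the two new
  edges may reuse the name \<open>e\<close>.\<close>

definition edge_subdivision :: "('v, 'e, 'i) ohg \<Rightarrow> ('v, 'e, 'i) ohg \<Rightarrow> bool" where
  "edge_subdivision H H' \<longleftrightarrow> oriented_hypergraph H \<and> oriented_hypergraph H' \<and>
     (\<exists>e e\<^sub>1 e\<^sub>2 w j\<^sub>1 j\<^sub>2.
        e \<in> edges H \<and> e\<^sub>1 \<noteq> e\<^sub>2 \<and> e\<^sub>1 \<notin> edges H - {e} \<and> e\<^sub>2 \<notin> edges H - {e} \<and>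
        w \<notin> verts H \<and> j\<^sub>1 \<noteq> j\<^sub>2 \<and> j\<^sub>1 \<notin> incs H \<and> j\<^sub>2 \<notin> incs H \<and>
        verts H' = insert w (verts H) \<and>
        edges H' = edges H - {e} \<union> {e\<^sub>1, e\<^sub>2} \<and>
        incs H' = incs H \<union> {j\<^sub>1, j\<^sub>2} \<and>
        inc_map H' j\<^sub>1 = (w, e\<^sub>1) \<and> inc_map H' j\<^sub>2 = (w, e\<^sub>2) \<and>
        edge_incs H' e\<^sub>1 \<inter> edge_incs H' e\<^sub>2 = {} \<and>
        (edge_incs H' e\<^sub>1 - {j\<^sub>1}) \<union> (edge_incs H' e\<^sub>2 - {j\<^sub>2}) = edge_incs H e \<and>
        (\<forall>i \<in> edge_incs H e. fst (inc_map H' i) = fst (inc_map H i)) \<and>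
        (\<forall>i \<in> incs H - edge_incs H e. inc_map H' i = inc_map H i) \<and>
        (\<forall>i \<in> incs H. orient H' i = orient H i))"

abbreviation subdivision :: "('v, 'e, 'i) ohg \<Rightarrow> ('v, 'e, 'i) ohg \<Rightarrow> bool" where
  "subdivision \<equiv> edge_subdivision\<^sup>*\<^sup>*"

text \<open>Let \<open>G\<close> be a subdivision of \<open>H\<close>. An edge of \<open>H\<close> becomes a tree in \<open>G\<close>, so a
  circle of \<open>H\<close> becomes a circle of \<open>G\<close> by replacing each passage \<open>i, e, i'\<close> through an edge by
  the unique path from \<open>i\<close> to \<open>i'\<close> in the tree of \<open>e\<close>. Since \<open>incs H \<subseteq> incs G\<close>, this is the circle
  of \<open>G\<close>, unique up to starting point and direction, that contains the incidences of the original
  circle and no other incidences of \<open>H\<close>.\<close>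

definition corresponding_circles ::
    "('v, 'e, 'i) ohg \<Rightarrow> ('v, 'e, 'i) ohg \<Rightarrow> ('v, 'e, 'i) trail \<Rightarrow> ('v, 'e, 'i) trail \<Rightarrow> bool" where
  "corresponding_circles H G C D \<longleftrightarrow>
     is_circle H C \<and> is_circle G D \<and> set (snd D) \<inter> incs H = set (snd C)"

definition balanced_subdivision :: "('v, 'e, 'i) ohg \<Rightarrow> ('v, 'e, 'i) ohg \<Rightarrow> bool" where
  "balanced_subdivision H G \<longleftrightarrow> subdivision H G \<and>
     (\<forall>C D. corresponding_circles H G C D \<longrightarrow> circle_sign G D = circle_sign H C)"

end

theory Submission
  imports Defs
begin

text \<open>Every inner vertex of a path of the cross-theta has degree two, so a vector annihilated by
  the rows of all inner vertices is determined, up to signs, by its entry at the common end edge \<open>e\<close>: either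
  all its entries vanish or none does. A nonzero such vector is also annihilated by the row of the end vertex \<open>v\<close> iff the
  signs of the paths sum to zero. Vertices created by subdividing have degree two, so \<open>v\<close>,
  of degree at least three, is the vertex of \<open>L\<close>, and the first incidences of the paths
  are the incidences of \<open>L\<close>. Two paths close up to the circle corresponding to their
  first incidences, so balance makes the sign of a path equal to the orientation of its
  first incidence up to a common factor, and the sum is \<open>\<plusminus>(p - n)\<close>, which vanishes in a field of
  \<open>\<bar>p - n\<bar>\<close> elements.\<close>

section \<open>Rows of the incidence matrix as sums over incidences\<close>

definition vert_incs :: "('v, 'e, 'i) ohg \<Rightarrow> 'v \<Rightarrow> 'i set" where
  "vert_incs G v = {i \<in> incs G. fst (inc_map G i) = v}"

lemma (in oriented_hypergraph) finite_vert_incs: "finite (vert_incs G v)"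
  using finite_incs by (simp add: vert_incs_def)

text \<open>Grouping the incidences at \<open>v\<close> by their edge recovers the matrix entries,
  parallel incidences included, since \<open>inc_map\<close> need not be injective.\<close>

lemma (in oriented_hypergraph) row_sum:
  fixes c :: "'e \<Rightarrow> 'f::comm_ring_1"
  shows "(\<Sum>f\<in>edges G. c f * of_int (incidence_matrix G v f)) =
    (\<Sum>i\<in>vert_incs G v. of_int (orient G i) * c (snd (inc_map G i)))"
proof -
  let ?h = "\<lambda>i. of_int (orient G i) * c (snd (inc_map G i))"
  have "c f * of_int (incidence_matrix G v f) =
      (\<Sum>i\<in>{i \<in> vert_incs G v. snd (inc_map G i) = f}. ?h i)" for f
  proof -
    have "{i \<in> incs G. inc_map G i = (v, f)} = {i \<in> vert_incs G v. snd (inc_map G i) = f}"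
      by (auto simp: vert_incs_def)
    then show ?thesis
      by (simp add: incidence_matrix_def sum_distrib_left mult.commute)
  qed
  moreover have "(\<lambda>i. snd (inc_map G i)) ` vert_incs G v \<subseteq> edges G"
    using inc_map_in by (force simp: vert_incs_def)
  ultimately show ?thesis
    using sum.group[OF finite_vert_incs finite_edges, of "\<lambda>i. snd (inc_map G i)" v ?h] by simp
qed

section \<open>Vertex degrees under subdivision\<close>

lemma edge_subdivisionE:
  assumes "edge_subdivision H H'"
  obtains e e\<^sub>1 e\<^sub>2 w j\<^sub>1 j\<^sub>2 where "oriented_hypergraph H" "w \<notin> verts H" "j\<^sub>1 \<noteq> j\<^sub>2"
    "verts H' = insert w (verts H)" "incs H' = incs H \<union> {j\<^sub>1, j\<^sub>2}"
    "inc_map H' j\<^sub>1 = (w, e\<^sub>1)" "inc_map H' j\<^sub>2 = (w, e\<^sub>2)"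
    "\<And>i. i \<in> edge_incs H e \<Longrightarrow> fst (inc_map H' i) = fst (inc_map H i)"
    "\<And>i. i \<in> incs H - edge_incs H e \<Longrightarrow> inc_map H' i = inc_map H i"
  using assms unfolding edge_subdivision_def
  by (elim conjE exE) (rule that; (assumption | erule (1) bspec))

lemma edge_subdivision_inc_vertex:
  assumes "edge_subdivision H H'" "i \<in> incs H"
  shows "fst (inc_map H' i) = fst (inc_map H i)"
proof -
  obtain e where e: "\<And>i. i \<in> edge_incs H e \<Longrightarrow> fst (inc_map H' i) = fst (inc_map H i)"
    "\<And>i. i \<in> incs H - edge_incs H e \<Longrightarrow> inc_map H' i = inc_map H i"
    by (rule edge_subdivisionE[OF assms(1)], rule that) auto
  then show ?thesis
    using assms(2) by (cases "i \<in> edge_incs H e") auto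
qed

lemma edge_subdivision_verts: "edge_subdivision H H' \<Longrightarrow> verts H \<subseteq> verts H'"
  by (auto elim: edge_subdivisionE)

text \<open>Old incidences keep their vertices and both new ones lie at the new vertex
  \<open>w\<close>, so an old vertex gains or loses nothing.\<close>

lemma edge_subdivision_vert_incs_old:
  assumes "edge_subdivision H H'" "u \<in> verts H"
  shows "vert_incs H' u = vert_incs H u"
proof (rule edge_subdivisionE[OF assms(1)])
  fix e e\<^sub>1 e\<^sub>2 w j\<^sub>1 j\<^sub>2
  assume w: "w \<notin> verts H" "incs H' = incs H \<union> {j\<^sub>1, j\<^sub>2}"
    "inc_map H' j\<^sub>1 = (w, e\<^sub>1)" "inc_map H' j\<^sub>2 = (w, e\<^sub>2)"
  then show ?thesis
    using assms(2) edge_subdivision_inc_vertex[OF assms(1)] by (auto simp: vert_incs_def)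
qed

lemma edge_subdivision_vert_incs_new:
  assumes "edge_subdivision H H'" "u \<in> verts H' - verts H"
  shows "card (vert_incs H' u) = 2"
proof (rule edge_subdivisionE[OF assms(1)])
  fix e e\<^sub>1 e\<^sub>2 w j\<^sub>1 j\<^sub>2
  assume w: "oriented_hypergraph H" "w \<notin> verts H" "incs H' = incs H \<union> {j\<^sub>1, j\<^sub>2}" "j\<^sub>1 \<noteq> j\<^sub>2"
    "verts H' = insert w (verts H)" "inc_map H' j\<^sub>1 = (w, e\<^sub>1)" "inc_map H' j\<^sub>2 = (w, e\<^sub>2)"
  have "fst (inc_map H' i) \<noteq> w" if "i \<in> incs H" for i
    using edge_subdivision_inc_vertex[OF assms(1) that]
      oriented_hypergraph.inc_map_in[OF w(1) that] w(2) by force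
  then have "vert_incs H' u = {j\<^sub>1, j\<^sub>2}"
    using assms(2) w(2-) by (auto simp: vert_incs_def)
  with w(4) show ?thesis by simp
qed

text \<open>A vertex created at some step is an old vertex of every later step, so its degree stays
  two. By degree, a vertex of \<open>L\<close> can thus be recognised in \<open>G\<close>.\<close>

lemma subdivision_vert_incs:
  assumes "subdivision H G"
  shows "u \<in> verts H \<Longrightarrow> vert_incs G u = vert_incs H u"
    and "u \<in> verts G - verts H \<Longrightarrow> card (vert_incs G u) = 2"
proof -
  have "verts H \<subseteq> verts G \<and>
    (\<forall>u\<in>verts H. vert_incs G u = vert_incs H u) \<and>
    (\<forall>u\<in>verts G - verts H. card (vert_incs G u) = 2)"
    using assms
  proof (induction rule: rtranclp_induct)
    case (step K K')
    have "card (vert_incs K' u) = 2" if "u \<in> verts K' - verts H" for u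
      using that step edge_subdivision_vert_incs_new[OF step(2)]
        edge_subdivision_vert_incs_old[OF step(2)]
      by (cases "u \<in> verts K") auto
    then show ?case
      using step edge_subdivision_verts[OF step(2)] edge_subdivision_vert_incs_old[OF step(2)]
      by (simp add: subset_iff)
  qed simp
  then show "u \<in> verts H \<Longrightarrow> vert_incs G u = vert_incs H u"
    and "u \<in> verts G - verts H \<Longrightarrow> card (vert_incs G u) = 2"
    by blast+
qed

section \<open>Walks: reversal, concatenation, alternation and signs\<close>

lemma joins_sym: "joins G i a b \<longleftrightarrow> joins G i b a"
  by (auto simp: joins_def)

lemma is_walk_rev:
  assumes "is_walk G (A, I)"
  shows "is_walk G (rev A, rev I)"
  unfolding is_walk_def fst_conv snd_conv
proof (intro conjI allI impI)
  show "length (rev A) = Suc (length (rev I))"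
    and "set (rev A) \<subseteq> Inl ` verts G \<union> Inr ` edges G"
    using assms by (simp_all add: is_walk_def)
  fix j assume j: "j < length (rev I)"
  define l where "l = length I - Suc j"
  have "joins G (I ! l) (A ! l) (A ! Suc l)"
    using assms j by (simp add: is_walk_def l_def)
  moreover have "rev I ! j = I ! l" "rev A ! j = A ! Suc l" "rev A ! Suc j = A ! l"
    using assms j by (simp_all add: is_walk_def l_def rev_nth Suc_diff_Suc)
  ultimately show "joins G (rev I ! j) (rev A ! j) (rev A ! Suc j)"
    using joins_sym by metis
qed

lemma is_walk_append:
  assumes "is_walk G (A, I)" "is_walk G (B, J)" "last A = hd B"
  shows "is_walk G (A @ tl B, I @ J)"
proof -
  obtain b B' where B: "B = b # B'"
    using assms(2) by (cases B) (auto simp: is_walk_def)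
  have lenA: "length A = Suc (length I)" and lenB: "length B' = length J"
    and sub: "set A \<subseteq> Inl ` verts G \<union> Inr ` edges G" "set B' \<subseteq> Inl ` verts G \<union> Inr ` edges G"
    and jA: "\<And>j. j < length I \<Longrightarrow> joins G (I ! j) (A ! j) (A ! Suc j)"
    and jB: "\<And>j. j < length J \<Longrightarrow> joins G (J ! j) ((b # B') ! j) (B' ! j)"
    using assms(1,2) by (auto simp: is_walk_def B)
  have lastA: "A ! length I = b"
    using assms(3) lenA B by (metis diff_Suc_1 last_conv_nth length_0_conv list.sel(1) nat.distinct(1))
  have "joins G ((I @ J) ! j) ((A @ B') ! j) ((A @ B') ! Suc j)" if j: "j < length (I @ J)" for j
  proof (cases "j < length I")
    case True
    then show ?thesis using jA lenA by (simp add: nth_append)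
  next
    case False
    then obtain d where d: "j = length I + d" "d < length J"
      using j by (metis add_less_cancel_left le_Suc_ex length_append not_less)
    have "(A @ B') ! j = (b # B') ! d"
      using d lenA lastA by (cases d) (simp_all add: nth_append)
    moreover have "(A @ B') ! Suc j = B' ! d"
      using d lenA by (simp add: nth_append)
    ultimately show ?thesis
      using jB[OF d(2)] d(1) by simp
  qed
  then show ?thesis
    using lenA lenB sub by (simp add: is_walk_def B)
qed

text \<open>The node shared by consecutive incidences fixes the direction in which
  \<open>joins\<close> is read. Hence parity of the position decides between vertex and edge, and
  each incidence names both of its neighbours.\<close>

lemma walk_alternates:
  assumes "is_walk G (A, I)" "hd A = Inl v" "s < length I"
  shows "if even s
    then A ! s = Inl (fst (inc_map G (I ! s))) \<and> A ! Suc s = Inr (snd (inc_map G (I ! s)))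
    else A ! s = Inr (snd (inc_map G (I ! s))) \<and> A ! Suc s = Inl (fst (inc_map G (I ! s)))"
  using assms(3)
proof (induction s)
  case 0
  have "A ! 0 = Inl v"
    using assms(1,2) by (cases A) (auto simp: is_walk_def)
  moreover have "joins G (I ! 0) (A ! 0) (A ! Suc 0)"
    using assms(1) 0 by (simp add: is_walk_def)
  ultimately show ?case
    by (auto simp: joins_def)
next
  case (Suc s)
  have "joins G (I ! Suc s) (A ! Suc s) (A ! Suc (Suc s))"
    using assms(1) Suc.prems by (simp add: is_walk_def)
  with Suc show ?case
    by (auto simp: joins_def split: if_splits)
qed

text \<open>Halving two odd lengths separately loses one half each; the two halves together give the
  extra factor -1. The node lists are arbitrary because the sign depends on the incidences
  alone.\<close>

lemma circle_sign_append_rev: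
  assumes "odd (length I)" "odd (length J)"
  shows "circle_sign G (A, I @ rev J) = - (circle_sign G (B, I) * circle_sign G (C, J))"
proof -
  have "length (I @ rev J) div 2 = Suc (length I div 2 + length J div 2)"
    using assms by (auto elim!: oddE)
  then show ?thesis
    by (simp add: circle_sign_def power_add prod_list.rev flip: rev_map)
qed

section \<open>Coordinates on a minimal cross-theta\<close>

locale cross_theta = oriented_hypergraph G for G :: "('v, 'e, 'i) ohg" +
  fixes k :: nat and P :: "nat \<Rightarrow> ('v, 'e, 'i) trail" and v :: 'v and e :: 'e
  assumes k_pos: "0 < k"
    and path: "j < k \<Longrightarrow> is_path G (P j)"
    and odd_length: "j < k \<Longrightarrow> odd (length (snd (P j)))"
    and hd_path: "j < k \<Longrightarrow> hd (fst (P j)) = Inl v"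
    and last_path: "j < k \<Longrightarrow> last (fst (P j)) = Inr e"
    and disjoint: "\<lbrakk>j < k; l < k; j \<noteq> l\<rbrakk> \<Longrightarrow> internally_disjoint (P j) (P l)"
    and nodes_eq: "Inl ` verts G \<union> Inr ` edges G = (\<Union>j<k. set (fst (P j)))"
    and incs_eq: "incs G = (\<Union>j<k. set (snd (P j)))"
begin

definition r :: "nat \<Rightarrow> nat" where
  "r j = length (snd (P j)) div 2"

definition inc :: "nat \<Rightarrow> nat \<Rightarrow> 'i" where
  "inc j s = snd (P j) ! s"

text \<open>The path \<open>P j\<close> reads \<open>v = x j 0, y j 0, x j 1, \<dots>, x j (r j), y j (r j) = e\<close>.\<close>

definition x :: "nat \<Rightarrow> nat \<Rightarrow> 'v" where
  "x j t = fst (inc_map G (inc j (2 * t)))"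

definition y :: "nat \<Rightarrow> nat \<Rightarrow> 'e" where
  "y j t = snd (inc_map G (inc j (2 * t)))"

lemma length_incs: "j < k \<Longrightarrow> length (snd (P j)) = Suc (2 * r j)"
  using odd_length[of j] by (simp add: r_def)

lemma walk: "j < k \<Longrightarrow> is_walk G (fst (P j), snd (P j))"
  using path by (simp add: is_path_def)

lemma length_nodes: "j < k \<Longrightarrow> length (fst (P j)) = Suc (Suc (2 * r j))"
  using walk[of j] by (simp add: is_walk_def length_incs)

lemma node_x: "\<lbrakk>j < k; t \<le> r j\<rbrakk> \<Longrightarrow> fst (P j) ! (2 * t) = Inl (x j t)"
  using walk_alternates[OF walk hd_path, of j "2 * t"] by (simp add: x_def inc_def length_incs)

lemma node_y: "\<lbrakk>j < k; t \<le> r j\<rbrakk> \<Longrightarrow> fst (P j) ! Suc (2 * t) = Inr (y j t)"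
  using walk_alternates[OF walk hd_path, of j "2 * t"] by (simp add: y_def inc_def length_incs)

text \<open>No index bounds occur because \<open>x\<close> and \<open>y\<close> are both read off
  the even incidences; at the odd ones the alternation along the path is needed.\<close>

lemma inc_map_even: "inc_map G (inc j (2 * t)) = (x j t, y j t)"
  by (simp add: x_def y_def)

lemma inc_map_odd:
  assumes "j < k" "t < r j"
  shows "inc_map G (inc j (Suc (2 * t))) = (x j (Suc t), y j t)"
  using walk_alternates[OF walk hd_path, of j "Suc (2 * t)"] assms
    node_x[of j "Suc t"] node_y[of j t]
  by (simp add: inc_def length_incs prod_eq_iff)

lemma x_0: "j < k \<Longrightarrow> x j 0 = v"
  using node_x[of j 0] hd_path[of j] length_nodes[of j]
  by (cases "fst (P j)") auto

lemma y_r: "j < k \<Longrightarrow> y j (r j) = e"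
  using node_y[of j "r j"] last_path[of j] length_nodes[of j]
  by (cases "fst (P j)" rule: rev_cases) (auto simp: nth_append)

text \<open>The entries of \<open>butlast (tl (fst (P j)))\<close> are those strictly between the
  first and the last position, so internal disjointness leaves only the two ends to share.\<close>

lemma inner_node:
  assumes "j < k" "l < k" "j \<noteq> l" "s < length (fst (P j))" "fst (P j) ! s \<in> set (fst (P l))"
  shows "s = 0 \<or> s = Suc (2 * r j)"
proof (rule ccontr)
  assume "\<not> ?thesis"
  with assms(4) have s: "0 < s" "s < Suc (2 * r j)"
    using length_nodes[OF assms(1)] by auto
  then have "fst (P j) ! s = butlast (tl (fst (P j))) ! (s - 1)"
    using length_nodes[OF assms(1)] by (simp add: nth_butlast nth_tl)
  moreover have "s - 1 < length (butlast (tl (fst (P j))))"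
    using s length_nodes[OF assms(1)] by simp
  ultimately have "fst (P j) ! s \<in> set (butlast (tl (fst (P j))))"
    by (metis nth_mem)
  then show False
    using disjoint[OF assms(1-3)] assms(5) by (auto simp: internally_disjoint_def)
qed

text \<open>Within a path nodes are distinct. Different paths share only end positions, and a vertex
  sits at an even position, while the last position is odd; so only the first one remains.\<close>

lemma x_eqD:
  assumes "j < k" "t \<le> r j" "l < k" "u \<le> r l" "x j t = x l u"
  shows "j = l \<and> t = u \<or> t = 0 \<and> u = 0"
proof (cases "j = l")
  case True
  then have "fst (P j) ! (2 * t) = fst (P j) ! (2 * u)"
    using assms node_x by metis
  then have "2 * t = 2 * u"
    using assms True path[of j] length_nodes[of j] by (simp add: is_path_def nth_eq_iff_index_eq)
  with True show ?thesis by simp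
next
  case False
  have eq: "fst (P j) ! (2 * t) = fst (P l) ! (2 * u)"
    using assms node_x by metis
  have "fst (P j) ! (2 * t) \<in> set (fst (P j))" "fst (P l) ! (2 * u) \<in> set (fst (P l))"
    using assms length_nodes by simp_all
  with eq have "2 * t = 0 \<or> 2 * t = Suc (2 * r j)" "2 * u = 0 \<or> 2 * u = Suc (2 * r l)"
    using inner_node[of j l "2 * t"] inner_node[of l j "2 * u"] False assms length_nodes by auto
  then show ?thesis by presburger
qed

text \<open>Dual to \<open>x_eqD\<close>: edges sit at odd positions, so only the last one can be
  shared.\<close>

lemma y_eqD:
  assumes "j < k" "t \<le> r j" "l < k" "u \<le> r l" "y j t = y l u"
  shows "j = l \<and> t = u \<or> t = r j \<and> u = r l"
proof (cases "j = l")
  case True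
  then have "fst (P j) ! Suc (2 * t) = fst (P j) ! Suc (2 * u)"
    using assms node_y by metis
  then have "2 * t = 2 * u"
    using assms True path[of j] length_nodes[of j] by (simp add: is_path_def nth_eq_iff_index_eq)
  with True show ?thesis by simp
next
  case False
  have eq: "fst (P j) ! Suc (2 * t) = fst (P l) ! Suc (2 * u)"
    using assms node_y by metis
  have "fst (P j) ! Suc (2 * t) \<in> set (fst (P j))" "fst (P l) ! Suc (2 * u) \<in> set (fst (P l))"
    using assms length_nodes by simp_all
  with eq show ?thesis
    using inner_node[of j l "Suc (2 * t)"] inner_node[of l j "Suc (2 * u)"] False assms length_nodes
    by auto
qed

lemma edges_cases:
  assumes "f \<in> edges G"
  obtains j t where "j < k" "t \<le> r j" "f = y j t"
proof -
  obtain j where j: "j < k" "Inr f \<in> set (fst (P j))"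
    using assms nodes_eq by blast
  then obtain s where s: "s < Suc (Suc (2 * r j))" "fst (P j) ! s = Inr f"
    using length_nodes by (metis in_set_conv_nth)
  show ?thesis
  proof (cases "even s")
    case True
    then show ?thesis using s node_x[OF j(1), of "s div 2"] by auto
  next
    case False
    then obtain t where "s = Suc (2 * t)" by (auto elim: oddE)
    then show ?thesis using s node_y[OF j(1), of t] j(1) that[of j t] by auto
  qed
qed

lemma verts_cases:
  assumes "w \<in> verts G"
  obtains j t where "j < k" "t \<le> r j" "w = x j t"
proof -
  obtain j where j: "j < k" "Inl w \<in> set (fst (P j))"
    using assms nodes_eq by blast
  then obtain s where s: "s < Suc (Suc (2 * r j))" "fst (P j) ! s = Inl w"
    using length_nodes by (metis in_set_conv_nth)
  show ?thesis
  proof (cases "even s")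
    case True
    then obtain t where "s = 2 * t" by (auto elim: evenE)
    then show ?thesis using s node_x[OF j(1), of t] j(1) that[of j t] by auto
  next
    case False
    then obtain t where "s = Suc (2 * t)" by (auto elim: oddE)
    then show ?thesis using s node_y[OF j(1), of t] by auto
  qed
qed

lemma inc_in: "\<lbrakk>j < k; s \<le> 2 * r j\<rbrakk> \<Longrightarrow> inc j s \<in> incs G"
  using length_incs[of j] by (auto simp: incs_eq inc_def intro!: bexI[of _ j])

lemma x_in: "\<lbrakk>j < k; t \<le> r j\<rbrakk> \<Longrightarrow> x j t \<in> verts G"
  using inc_map_in[OF inc_in[of j "2 * t"]] by (simp add: inc_map_even)

lemma y_in: "\<lbrakk>j < k; t \<le> r j\<rbrakk> \<Longrightarrow> y j t \<in> edges G"
  using inc_map_in[OF inc_in[of j "2 * t"]] by (simp add: inc_map_even)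

lemma incs_cases:
  assumes "i \<in> incs G"
  obtains (even) j t where "j < k" "t \<le> r j" "i = inc j (2 * t)"
  | (odd) j t where "j < k" "t < r j" "i = inc j (Suc (2 * t))"
proof -
  obtain j where j: "j < k" "i \<in> set (snd (P j))"
    using assms incs_eq by blast
  then obtain s where s: "s < Suc (2 * r j)" "i = inc j s"
    unfolding inc_def using length_incs by (metis in_set_conv_nth)
  show ?thesis
  proof (cases "even s")
    case True
    then show ?thesis using s even[of j "s div 2"] j(1) by auto
  next
    case False
    then obtain t where "s = Suc (2 * t)" by (auto elim: oddE)
    then show ?thesis using s odd[of j t] j(1) by auto
  qed
qed

text \<open>By minimality every incidence lies on some path, and \<open>x_eqD\<close> leaves only
  the two that surround this vertex.\<close>

lemma vert_incs_inner:
  assumes "j < k" "t < r j"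
  shows "vert_incs G (x j (Suc t)) = {inc j (Suc (2 * t)), inc j (2 * Suc t)}"
proof (intro subset_antisym subsetI)
  fix i assume "i \<in> vert_incs G (x j (Suc t))"
  then have i: "i \<in> incs G" "fst (inc_map G i) = x j (Suc t)"
    by (auto simp: vert_incs_def)
  from i(1) show "i \<in> {inc j (Suc (2 * t)), inc j (2 * Suc t)}"
  proof (cases rule: incs_cases)
    case (even l u)
    then show ?thesis
      using i(2) x_eqD[of l u j "Suc t"] assms by (auto simp: inc_map_even)
  next
    case (odd l u)
    then show ?thesis
      using i(2) x_eqD[of l "Suc u" j "Suc t"] assms by (auto simp: inc_map_odd)
  qed
next
  fix i assume "i \<in> {inc j (Suc (2 * t)), inc j (2 * Suc t)}"
  then show "i \<in> vert_incs G (x j (Suc t))"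
    using assms inc_in[of j "Suc (2 * t)"] inc_in[of j "2 * Suc t"] inc_map_even[of j "Suc t"]
    by (auto simp: vert_incs_def inc_map_odd)
qed

lemma inc_inj:
  assumes "j < k" "s \<le> 2 * r j" "u \<le> 2 * r j" "inc j s = inc j u"
  shows "s = u"
  using assms path[of j] length_incs[of j] by (simp add: is_path_def inc_def nth_eq_iff_index_eq)

lemma vert_incs_end: "vert_incs G v = (\<lambda>j. inc j 0) ` {..<k}"
proof (intro subset_antisym subsetI)
  fix i assume "i \<in> vert_incs G v"
  \<comment> \<open>Naming \<open>v\<close> as \<open>x 0 0\<close> makes \<open>x_eqD\<close>
    applicable; it excludes odd incidences, whose vertex \<open>x l (Suc u)\<close> never has second
    index 0.\<close>
  then have i: "i \<in> incs G" "fst (inc_map G i) = x 0 0"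
    using x_0 k_pos by (auto simp: vert_incs_def)
  from i(1) show "i \<in> (\<lambda>j. inc j 0) ` {..<k}"
  proof (cases rule: incs_cases)
    case (even l u)
    then show ?thesis
      using i(2) x_eqD[of l u 0 0] k_pos by (auto simp: inc_map_even)
  next
    case (odd l u)
    then show ?thesis
      using i(2) x_eqD[of l "Suc u" 0 0] k_pos by (auto simp: inc_map_odd)
  qed
next
  fix i assume "i \<in> (\<lambda>j. inc j 0) ` {..<k}"
  then show "i \<in> vert_incs G v"
    using inc_in[of _ 0] inc_map_even[of _ 0] x_0 by (auto simp: vert_incs_def)
qed

lemma inj_first_inc: "inj_on (\<lambda>j. inc j 0) {..<k}"
proof (rule inj_onI, rule ccontr)
  fix j l assume jl: "j \<in> {..<k}" "l \<in> {..<k}" "inc j 0 = inc l 0" "j \<noteq> l"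
  then have "inc j 0 \<in> set (snd (P j)) \<inter> set (snd (P l))"
    using length_incs[of j] length_incs[of l] nth_mem[of 0 "snd (P j)"] nth_mem[of 0 "snd (P l)"]
    by (simp add: inc_def)
  with disjoint[of j l] jl show False
    by (auto simp: internally_disjoint_def)
qed

lemma card_vert_incs_end: "card (vert_incs G v) = k"
  by (simp add: vert_incs_end card_image inj_first_inc)

section \<open>Signs along the paths and the kernel of the incidence matrix\<close>

text \<open>Balance of the rows at the inner vertices of \<open>P j\<close> forces the coefficient of \<open>y j t\<close> to be
  proportional to \<open>sg j t\<close>.\<close>

definition sg :: "nat \<Rightarrow> nat \<Rightarrow> int" where
  "sg j t = (-1) ^ t * (\<Prod>s\<le>2 * t. orient G (inc j s))"

lemma orient_sq: "\<lbrakk>j < k; s \<le> 2 * r j\<rbrakk> \<Longrightarrow> orient G (inc j s) * orient G (inc j s) = 1"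
  using orient_in[OF inc_in[of j s]] by auto

lemma sg_Suc:
  "sg j (Suc t) = - (orient G (inc j (Suc (2 * t))) * orient G (inc j (2 * Suc t)) * sg j t)"
  by (simp add: sg_def mult_ac)

lemma sg_sq: "\<lbrakk>j < k; t \<le> r j\<rbrakk> \<Longrightarrow> sg j t * sg j t = 1"
proof (induction t)
  case 0
  then show ?case using orient_sq[of j 0] by (simp add: sg_def)
next
  case (Suc t)
  have "sg j (Suc t) * sg j (Suc t) =
    (orient G (inc j (Suc (2 * t))) * orient G (inc j (Suc (2 * t)))) *
    (orient G (inc j (2 * Suc t)) * orient G (inc j (2 * Suc t))) * (sg j t * sg j t)"
    by (simp add: sg_Suc mult_ac)
  also have "\<dots> = 1"
    using Suc orient_sq[of j "Suc (2 * t)"] orient_sq[of j "2 * Suc t"] by simp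
  finally show ?case .
qed

text \<open>The partial sign at the last edge is the sign of the whole path, because the odd length
  2r + 1 halves to r. Here \<open>circle_sign\<close> is applied to a path.\<close>

lemma sg_r: "j < k \<Longrightarrow> sg j (r j) = circle_sign G (P j)"
  using length_incs[of j]
  by (simp add: sg_def circle_sign_def inc_def r_def[symmetric] prod.list_conv_set_nth
      atLeast0LessThan lessThan_Suc_atMost)

text \<open>By \<open>row_sum\<close> this is the entry at \<open>w\<close> of the incidence matrix
  applied to \<open>c\<close>.\<close>

definition row :: "('e \<Rightarrow> 'f::comm_ring_1) \<Rightarrow> 'v \<Rightarrow> 'f" where
  "row c w = (\<Sum>i\<in>vert_incs G w. of_int (orient G i) * c (snd (inc_map G i)))"

lemma row_inner:
  assumes "j < k" "t < r j"
  shows "row c (x j (Suc t)) = of_int (orient G (inc j (Suc (2 * t)))) * c (y j t) +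
    of_int (orient G (inc j (2 * Suc t))) * c (y j (Suc t))"
proof -
  have "inc j (Suc (2 * t)) \<noteq> inc j (2 * Suc t)"
    using inc_inj[of j "Suc (2 * t)" "2 * Suc t"] assms by auto
  then show ?thesis
    using inc_map_odd[OF assms] inc_map_even[of j "Suc t"]
    by (simp add: row_def vert_incs_inner[OF assms])
qed

lemma row_end: "row c v = (\<Sum>j<k. of_int (orient G (inc j 0)) * c (y j 0))"
  using inc_map_even[of _ 0] by (simp add: row_def vert_incs_end sum.reindex[OF inj_first_inc])

text \<open>Each inner row has two terms, and solving it for the later coefficient reproduces the
  recursion \<open>sg_Suc\<close>. The factor \<open>orient G (inc j 0)\<close> cancels
  \<open>sg j 0\<close>.\<close>

lemma kernel_first:
  fixes c :: "'e \<Rightarrow> 'f::comm_ring_1"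
  assumes "\<forall>w\<in>verts G. row c w = 0" "j < k" "t \<le> r j"
  shows "c (y j t) = of_int (sg j t) * (of_int (orient G (inc j 0)) * c (y j 0))"
  using assms(3)
proof (induction t)
  case 0
  have "of_int (orient G (inc j 0) * orient G (inc j 0)) * c (y j 0) = c (y j 0)"
    using orient_sq[OF assms(2), of 0] by simp
  then show ?case by (simp add: sg_def mult_ac)
next
  case (Suc t)
  let ?a = "orient G (inc j (Suc (2 * t)))" and ?b = "orient G (inc j (2 * Suc t))"
  have "of_int ?a * c (y j t) + of_int ?b * c (y j (Suc t)) = 0"
    using Suc.prems assms(1,2) row_inner[of j t c] x_in by simp
  \<comment> \<open>Division is replaced by multiplication with \<open>?b\<close>, which is its own
    inverse.\<close>
  then have "of_int ?b * (of_int ?b * c (y j (Suc t))) = of_int ?b * (- of_int ?a * c (y j t))"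
    by (simp add: add_eq_0_iff)
  moreover have "of_int ?b * (of_int ?b * c (y j (Suc t))) = c (y j (Suc t))"
    using orient_sq[OF assms(2), of "2 * Suc t"] Suc.prems
    by (metis Suc_le_mono mult.assoc mult_1 mult_le_mono2 of_int_1 of_int_mult)
  ultimately show ?case
    using Suc by (simp add: sg_Suc mult_ac)
qed

text \<open>The edge \<open>e\<close> is common to all paths and serves as base point. The factors
  being signs, the second equation carries a zero from any edge to \<open>e\<close>, and the first
  carries it from \<open>e\<close> to every edge.\<close>

lemma kernel_last:
  fixes c :: "'e \<Rightarrow> 'f::comm_ring_1"
  assumes "\<forall>w\<in>verts G. row c w = 0" "j < k" "t \<le> r j"
  shows "c (y j t) = of_int (sg j t * sg j (r j)) * c e"
    and "c e = of_int (sg j t * sg j (r j)) * c (y j t)"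
proof -
  let ?d = "of_int (orient G (inc j 0)) * c (y j 0)"
  have t: "c (y j t) = of_int (sg j t) * ?d"
    using kernel_first[OF assms] .
  have r: "c e = of_int (sg j (r j)) * ?d"
    using kernel_first[OF assms(1,2), of "r j"] y_r[OF assms(2)] by simp
  have "of_int (sg j t * sg j (r j)) * c e = of_int (sg j (r j) * sg j (r j)) * (of_int (sg j t) * ?d)"
    unfolding r by (simp add: mult_ac)
  then show "c (y j t) = of_int (sg j t * sg j (r j)) * c e"
    using t sg_sq[OF assms(2), of "r j"] by simp
  have "of_int (sg j t * sg j (r j)) * c (y j t) = of_int (sg j t * sg j t) * (of_int (sg j (r j)) * ?d)"
    unfolding t by (simp add: mult_ac)
  then show "c e = of_int (sg j t * sg j (r j)) * c (y j t)"
    using r sg_sq[OF assms(2,3)] by simp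
qed

lemma kernel_vector:
  fixes F :: "'f::comm_ring_1 itself"
  assumes "of_int (\<Sum>j<k. circle_sign G (P j)) = (0::'f)"
  obtains c :: "'e \<Rightarrow> 'f" where "\<forall>w\<in>verts G. row c w = 0" "c e = 1"
proof -
  define g :: "nat \<Rightarrow> nat \<Rightarrow> 'f" where "g j t = of_int (sg j t * sg j (r j))" for j t
  \<comment> \<open>Only \<open>e\<close> has several names \<open>y j t\<close>. All of them have
    \<open>t = r j\<close>, where \<open>g\<close> is the square of a sign, so every choice yields
    the value 1.\<close>
  define c where "c f = (SOME a. \<exists>j<k. \<exists>t\<le>r j. f = y j t \<and> a = g j t)" for f
  have c: "c (y j t) = g j t" if jt: "j < k" "t \<le> r j" for j t
  proof -
    have "g l u = g j t" if "l < k" "u \<le> r l" "y j t = y l u" for l u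
      using y_eqD[OF jt that] sg_sq[OF jt(1), of "r j"] sg_sq[OF that(1), of "r l"]
      by (auto simp: g_def simp del: of_int_mult)
    then show ?thesis
      unfolding c_def using jt by (intro some_equality) blast+
  qed
  have "c e = 1"
    using c[OF k_pos order_refl] y_r[OF k_pos] sg_sq[OF k_pos order_refl] by (simp add: g_def)
  moreover have "row c v = 0"
  proof -
    \<comment> \<open>The first orientation cancels \<open>sg j 0\<close>, so each path contributes
      its sign to the row of \<open>v\<close>.\<close>
    have "of_int (orient G (inc j 0)) * c (y j 0) = of_int (circle_sign G (P j))" if "j < k" for j
    proof -
      have "of_int (orient G (inc j 0)) * c (y j 0) =
          (of_int (orient G (inc j 0) * orient G (inc j 0) * sg j (r j)) :: 'f)"
        using c[OF that, of 0] by (simp add: g_def sg_def mult_ac)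
      then show ?thesis
        using orient_sq[OF that, of 0] sg_r[OF that] by simp
    qed
    then show ?thesis
      using assms by (simp add: row_end)
  qed
  moreover have "row c (x j (Suc t)) = 0" if "j < k" "t < r j" for j t
  proof -
    let ?a = "orient G (inc j (Suc (2 * t)))" and ?b = "orient G (inc j (2 * Suc t))"
    have "?b * sg j (Suc t) = - (?b * ?b * (?a * sg j t))"
      by (simp add: sg_Suc mult_ac)
    then have "?a * sg j t + ?b * sg j (Suc t) = 0"
      using orient_sq[OF that(1), of "2 * Suc t"] that by simp
    then have "(?a * sg j t + ?b * sg j (Suc t)) * sg j (r j) = 0"
      by simp
    then have "of_int (?a * (sg j t * sg j (r j)) + ?b * (sg j (Suc t) * sg j (r j))) = (0::'f)"
      by (simp only: distrib_right mult.assoc of_int_0)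
    then show ?thesis
      using c[of j t] c[of j "Suc t"] that by (simp add: row_inner g_def)
  qed
  \<comment> \<open>Every vertex is some \<open>x j t\<close>: it is \<open>v\<close> for
    \<open>t = 0\<close> and inner otherwise.\<close>
  then have "row c w = 0" if "w \<in> verts G" for w
    using that \<open>row c v = 0\<close> x_0
    by (metis Suc_le_eq not0_implies_Suc verts_cases)
  ultimately show ?thesis
    using that by blast
qed

lemma minimally_dependent:
  assumes "of_int (\<Sum>j<k. circle_sign G (P j)) = (0::'f::field)"
  shows "minimally_dependent TYPE('f) G"
  unfolding minimally_dependent_def
proof (intro conjI allI impI)
  obtain c :: "'e \<Rightarrow> 'f" where c: "\<forall>w\<in>verts G. row c w = 0" "c e = 1"
    using kernel_vector assms by blast
  have "e \<in> edges G"
    using y_in[OF k_pos order_refl] y_r[OF k_pos] by simp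
  then show "\<not> columns_independent TYPE('f) G (edges G)"
    using c by (auto simp: columns_independent_def row_sum row_def intro!: exI[of _ c] bexI[of _ e])
next
  fix S assume S: "S \<subset> edges G"
  show "columns_independent TYPE('f) G S"
    unfolding columns_independent_def
  proof (intro allI impI)
    fix c :: "'e \<Rightarrow> 'f"
    assume c: "\<forall>w\<in>verts G. (\<Sum>f\<in>S. c f * of_int (incidence_matrix G w f)) = 0"
    \<comment> \<open>Extended by zero, a relation among the columns in \<open>S\<close> becomes a
      kernel vector vanishing at an edge outside \<open>S\<close>. By \<open>kernel_last\<close> the
      zero spreads to \<open>e\<close> and from there to all edges.\<close>
    define d where "d f = (if f \<in> S then c f else 0)" for f
    have "(\<Sum>f\<in>edges G. d f * of_int (incidence_matrix G w f)) =
      (\<Sum>f\<in>S. c f * of_int (incidence_matrix G w f))" for w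
      using S finite_edges by (intro sum.mono_neutral_cong_right) (auto simp: d_def)
    then have d: "\<forall>w\<in>verts G. row d w = 0"
      using c by (simp add: row_def flip: row_sum)
    obtain f where f: "f \<in> edges G" "d f = 0"
      using S by (metis d_def psubset_imp_ex_mem Diff_iff)
    then have "d e = 0"
      using kernel_last(2)[OF d] by (metis edges_cases mult_zero_right)
    then have "d g = 0" if "g \<in> edges G" for g
      using that kernel_last(1)[OF d] by (metis edges_cases mult_zero_right)
    then have "d f = 0" if "f \<in> S" for f
      using that S by blast
    then show "\<forall>f\<in>S. c f = 0"
      by (simp add: d_def)
  qed
qed

section \<open>Circles formed by two paths\<close>

definition join :: "nat \<Rightarrow> nat \<Rightarrow> ('v, 'e, 'i) trail" where
  "join j l = (fst (P j) @ tl (rev (fst (P l))), snd (P j) @ rev (snd (P l)))"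

text \<open>The two paths share only their ends. The \<open>tl\<close> in \<open>join\<close> drops
  the second \<open>Inr e\<close> and the \<open>butlast\<close> in \<open>is_circle\<close> the
  closing \<open>Inl v\<close>, so every remaining node occurs once.\<close>

lemma is_circle_join:
  assumes "j < k" "l < k" "j \<noteq> l"
  shows "is_circle G (join j l)"
proof -
  have ends: "\<exists>B. fst (P m) = Inl v # B @ [Inr e]" if m: "m < k" for m
  proof -
    obtain a B' where B': "fst (P m) = a # B'" "length B' = Suc (2 * r m)"
      using length_nodes[OF m] by (cases "fst (P m)") auto
    then obtain B b where "B' = B @ [b]"
      by (cases B' rule: rev_cases) auto
    then show ?thesis
      using B' hd_path[OF m] last_path[OF m] by auto
  qed
  obtain A B where AB: "fst (P j) = Inl v # A @ [Inr e]" "fst (P l) = Inl v # B @ [Inr e]"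
    using ends assms by meson
  have "is_walk G (join j l)"
    unfolding join_def
    using is_walk_append[OF walk[OF assms(1)] is_walk_rev[OF walk[OF assms(2)]]]
    by (simp add: AB)
  moreover have "snd (join j l) \<noteq> []"
    using length_incs[OF assms(1)] by (auto simp: join_def)
  moreover have "distinct (butlast (fst (join j l)))" "distinct (snd (join j l))"
    using path[OF assms(1)] path[OF assms(2)] disjoint[OF assms]
    by (auto simp: join_def is_path_def internally_disjoint_def AB butlast_append)
  moreover have "hd (fst (join j l)) = last (fst (join j l))"
    by (simp add: join_def AB)
  ultimately show ?thesis
    by (simp add: is_circle_def)
qed

lemma circle_sign_join:
  assumes "j < k" "l < k"
  shows "circle_sign G (join j l) = - (circle_sign G (P j) * circle_sign G (P l))"
  unfolding join_def
  using circle_sign_append_rev[of "snd (P j)" "snd (P l)" G _ "fst (P j)" "fst (P l)"] odd_length assms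
  by simp

text \<open>Once the incidences at \<open>v\<close> are known to be those of \<open>L\<close>, this
  shows that \<open>join j l\<close> contains exactly two of them, the first incidences of its
  paths.\<close>

lemma path_meets_end:
  assumes "j < k"
  shows "set (snd (P j)) \<inter> vert_incs G v = {inc j 0}"
proof -
  have "i = inc j 0" if i: "i \<in> set (snd (P j))" "i \<in> vert_incs G v" for i
  proof (rule ccontr)
    assume ne: "i \<noteq> inc j 0"
    from i(2) obtain l where l: "l < k" "i = inc l 0"
      by (auto simp: vert_incs_end)
    then have "i \<in> set (snd (P l))"
      using length_incs[of l] by (simp add: inc_def)
    moreover have "l \<noteq> j"
      using l ne by auto
    ultimately show False
      using disjoint[OF assms l(1)] i(1) by (auto simp: internally_disjoint_def)
  qed
  moreover have "inc j 0 \<in> set (snd (P j))"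
    using length_incs[OF assms] by (simp add: inc_def)
  moreover have "inc j 0 \<in> vert_incs G v"
    using assms by (simp add: vert_incs_end)
  ultimately show ?thesis by blast
qed

end

section \<open>Vanishing of p - n in the field, and the conclusion\<close>

lemma of_nat_card_UNIV: "of_nat CARD('f) = (0::'f::{ring_1,finite})"
proof -
  \<comment> \<open>Translation by 1 permutes the ring, so adding 1 to every element leaves the
    total unchanged.\<close>
  have "(\<Sum>a\<in>UNIV. a + 1) = (\<Sum>a\<in>UNIV. a :: 'f)"
    by (rule sum.reindex_bij_witness[of _ "\<lambda>a. a - 1" "\<lambda>a. a + 1"]) auto
  then show ?thesis
    by (simp add: sum.distrib)
qed

theorem corollary4p1p4:
  fixes G L :: "('v, 'e, 'i) ohg" and p n :: nat
  assumes "p + n \<ge> 3"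
    and "primepow (nat \<bar>int p - int n\<bar>)"
    and "CARD('f::{field,finite}) = nat \<bar>int p - int n\<bar>"
    and "is_L (p + n) L"
    and "card {i \<in> incs L. orient L i = 1} = p"
    and "card {i \<in> incs L. orient L i = -1} = n"
    and "balanced_subdivision L G"
    and "minimal_cross_theta (p + n) G"
  shows "minimally_dependent TYPE('f) G"
proof -
  obtain P where P: "cross_theta_paths (p + n) G P"
    "Inl ` verts G \<union> Inr ` edges G = (\<Union>j<p + n. set (fst (P j)))"
    "incs G = (\<Union>j<p + n. set (snd (P j)))" and G: "oriented_hypergraph G"
    using assms(8) unfolding minimal_cross_theta_def by (elim conjE exE) (rule that)
  obtain v e where ve: "\<And>j. j < p + n \<Longrightarrow> is_path G (P j) \<and> odd (length (snd (P j))) \<and>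
        hd (fst (P j)) = Inl v \<and> last (fst (P j)) = Inr e"
    and dis: "\<And>j l. \<lbrakk>j < p + n; l < p + n; j \<noteq> l\<rbrakk> \<Longrightarrow> internally_disjoint (P j) (P l)"
    using P(1) unfolding cross_theta_paths_def by (elim conjE exE) (rule that; simp)
  interpret oriented_hypergraph G by (fact G)
  interpret cross_theta G "p + n" P v e
    by unfold_locales (use P(2,3) ve dis assms(1) in \<open>auto simp del: add_gr_0\<close>)
  have sub: "subdivision L G"
    using assms(7) by (simp add: balanced_subdivision_def)
  interpret L: oriented_hypergraph L
    using assms(4) by (simp add: is_L_def)
  obtain v\<^sub>0 e\<^sub>0 where L: "verts L = {v\<^sub>0}" "edges L = {e\<^sub>0}"
    using assms(4) by (auto simp: is_L_def card_1_singleton_iff)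
  have inc_L: "inc_map L i = (v\<^sub>0, e\<^sub>0)" if "i \<in> incs L" for i
    using L.inc_map_in[OF that] L by auto
  have "v \<in> verts G"
    using x_in[OF k_pos, of 0] x_0[OF k_pos] by simp
  \<comment> \<open>A vertex created by subdivision has degree two, whereas \<open>v\<close> has
    degree \<open>p + n\<close>, at least three.\<close>
  then have "v = v\<^sub>0"
    using subdivision_vert_incs(2)[OF sub, of v] card_vert_incs_end assms(1) L by auto
  then have at_v: "vert_incs G v = incs L"
    using subdivision_vert_incs(1)[OF sub, of v] L inc_L by (auto simp: vert_incs_def)
  define \<tau> where "\<tau> j = orient L (inc j 0)" for j
  have inc0: "inc j 0 \<in> incs L" if "j < p + n" for j
    using that at_v vert_incs_end by auto
  have sign_prod: "circle_sign G (P j) * circle_sign G (P l) = \<tau> j * \<tau> l"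
    if jl: "j < p + n" "l < p + n" "j \<noteq> l" for j l
  proof -
    \<comment> \<open>All incidences of \<open>L\<close> join the same two nodes, so any two of them
      form a circle; its counterpart in \<open>G\<close> is \<open>join j l\<close>.\<close>
    let ?C = "([Inl v\<^sub>0, Inr e\<^sub>0, Inl v\<^sub>0], [inc j 0, inc l 0]) :: ('v, 'e, 'i) trail"
    have "inc j 0 \<noteq> inc l 0"
      using inj_first_inc jl by (auto simp: inj_on_def)
    then have "is_circle L ?C"
      using inc0 jl inc_L L
      by (auto simp: is_circle_def is_walk_def joins_def less_Suc_eq)
    moreover have "set (snd (join j l)) \<inter> incs L = set (snd ?C)"
      using path_meets_end[OF jl(1)] path_meets_end[OF jl(2)] at_v by (auto simp: join_def)
    ultimately have "corresponding_circles L G ?C (join j l)"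
      using is_circle_join[OF jl] by (simp add: corresponding_circles_def)
    then have "circle_sign G (join j l) = circle_sign L ?C"
      using assms(7) unfolding balanced_subdivision_def by blast
    \<comment> \<open>Both signs carry a factor -1, one from \<open>circle_sign_join\<close> and one
      from the circle with two incidences, so these cancel.\<close>
    then show ?thesis
      using jl by (simp add: circle_sign_join) (simp add: circle_sign_def \<tau>_def)
  qed
  define s where "s j = circle_sign G (P j)" for j
  have \<tau>_sq: "\<tau> j * \<tau> j = 1" if "j < p + n" for j
    using L.orient_in[OF inc0[OF that]] by (auto simp: \<tau>_def)
  have s_sq: "s j * s j = 1" if "j < p + n" for j
    using sg_sq[OF that order_refl] sg_r[OF that] by (simp add: s_def)
  \<comment> \<open>Multiplying \<open>sign_prod\<close> for path 0 by \<open>s 0\<close> isolates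
    the common factor \<open>s 0 * \<tau> 0\<close>. Path 0 itself is separate because
    \<open>sign_prod\<close> compares distinct paths.\<close>
  have s_eq: "s j = s 0 * \<tau> 0 * \<tau> j" if "j < p + n" for j
  proof (cases "j = 0")
    case True
    then show ?thesis using \<tau>_sq[OF that] by (simp add: mult.assoc)
  next
    case False
    have "s j = s 0 * s 0 * s j"
      using s_sq[OF k_pos] by simp
    also have "\<dots> = s 0 * (\<tau> 0 * \<tau> j)"
      using sign_prod[OF k_pos that] False by (simp add: s_def mult.assoc)
    finally show ?thesis by (simp add: mult.assoc)
  qed
  have "(\<Sum>j<p + n. \<tau> j) = (\<Sum>i\<in>incs L. orient L i)"
    unfolding at_v[symmetric] vert_incs_end \<tau>_def by (simp add: sum.reindex[OF inj_first_inc])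
  also have "\<dots> = (\<Sum>i\<in>{i \<in> incs L. orient L i = 1} \<union> {i \<in> incs L. orient L i = -1}. orient L i)"
    using L.orient_in by (intro sum.cong) auto
  also have "\<dots> = int p - int n"
    using L.finite_incs assms(5,6) by (subst sum.union_disjoint) auto
  finally have "(\<Sum>j<p + n. s j) = s 0 * \<tau> 0 * (int p - int n)"
    using s_eq by (simp flip: sum_distrib_left)
  \<comment> \<open>The field annihilates its own cardinality |p - n|; removing the absolute value
    changes at most the sign.\<close>
  moreover have "of_int (int p - int n) = (0::'f)"
  proof -
    have "of_int \<bar>int p - int n\<bar> = (of_nat CARD('f) :: 'f)"
      by (simp add: assms(3))
    then have "of_int \<bar>int p - int n\<bar> = (0::'f)"
      by (simp only: of_nat_card_UNIV)
    then show ?thesis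
      by (simp add: abs_if split: if_splits)
  qed
  ultimately show ?thesis
    by (intro minimally_dependent) (simp only: s_def[symmetric] of_int_mult mult_zero_right)
qed

end
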